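(* Let $d\geq2$, put $r_c=\frac{2d}{d-1}$, fix an odd prime $\ell$, and let $N=\ell^k$, $k\ge1$. Let $P_N^{(d)}=\{(t,t_1^2+\cdots+t_{d-1}^2):t\in\mathbb Z_N^{d-1}\}\subseteq\mathbb Z_N^d$. Along the moduli $N=\ell^k$, $k\to\infty$, uniform spectral synthesis on $P_N^{(d)}$ at exponent $r\in[1,\infty)$ holds exactly for $1\leq r\leq r_c$. More precisely, for each $1\le r<\infty$, $$\mathcal C_r(P_{\ell^k}^{(d)})\asymp_{\ell,d,r}\begin{cases}N^{\frac{d-1}{2}-\frac{d}{r}},&1\leq r<r_c,\\ (\log N)^{-\frac{1}{r_c}},&r=r_c,\\ 1,&r>r_c.\end{cases}$$ At the endpoint the exact formula is $$\mathcal C_{r_c}(P_{\ell^k}^{(d)})=\left(1+k\left(1-\frac{1}{\ell}\right)\right)^{-\frac{1}{r_c}}.$$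
   Context: $\mathbb Z_N=\mathbb Z/N\mathbb Z$. For $f:\mathbb Z_N^d\to\mathbb C$ the unitary Fourier transform is $\widehat f(\xi)=N^{-d/2}\sum_{x\in\mathbb Z_N^d}f(x)e^{-2\pi i x\cdot\xi/N}$. All norms use counting measure: $\|f\|_r=(\sum_x|f(x)|^r)^{1/r}$, $\|f\|_\infty=\max_x|f(x)|$. For nonempty $S\subseteq\mathbb Z_N^d$ and $1\le r<\infty$, $$\mathcal C_r(S)=\sup_{f\neq0,\ \operatorname{supp}(f)\subseteq S}\frac{\|\widehat f\|_\infty}{\|\widehat f\|_r}.$$ A family of nonempty sets $\{S_N\}$, $S_N\subseteq\mathbb Z_N^d$, admits uniform spectral synthesis at exponent $r$ if every sequence of functions $f_N:\mathbb Z_N^d\to\mathbb C$ supported on $S_N$ satisfies: $\sup_N\|\widehat f_N\|_r<\infty$ implies $\|\widehat f_N\|_\infty\to0$. $A\asymp_{\ell,d,r}B$ means $cB\le A\le CB$ with positive constants $c,C$ depending only on $\ell,d,r$ (not on $k$). *)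

theory Defs
  imports "HOL-Analysis.Analysis" "HOL-Computational_Algebra.Primes"
begin

text \<open>
  \<open>zmod_vec d N\<close> is the group of vectors of length \<open>d\<close> over the integers modulo \<open>N\<close>. A residue
  class is represented by its least nonnegative representative and a vector by an extensional
  function on \<open>{..<d}\<close>. A complex function on this group is a function on \<open>nat \<Rightarrow> int\<close> whose values
  outside \<open>zmod_vec d N\<close> are never inspected.
\<close>

definition zmod_vec :: "nat \<Rightarrow> nat \<Rightarrow> (nat \<Rightarrow> int) set" where
  "zmod_vec d N = {..<d} \<rightarrow>\<^sub>E {0..<int N}"

text \<open>
  The dot product below is computed in the integers; the exponential depends only on its residue
  modulo \<open>N\<close>.
\<close>

definition fourier ::
  "nat \<Rightarrow> nat \<Rightarrow> ((nat \<Rightarrow> int) \<Rightarrow> complex) \<Rightarrow> (nat \<Rightarrow> int) \<Rightarrow> complex" where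
  "fourier d N f \<xi> =
     complex_of_real (real N powr (- real d / 2)) *
     (\<Sum>x\<in>zmod_vec d N.
        f x * exp (- 2 * complex_of_real pi * \<i> * of_int (\<Sum>i<d. x i * \<xi> i) / of_nat N))"

definition lnorm :: "nat \<Rightarrow> nat \<Rightarrow> real \<Rightarrow> ((nat \<Rightarrow> int) \<Rightarrow> complex) \<Rightarrow> real" where
  "lnorm d N r f = (\<Sum>x\<in>zmod_vec d N. cmod (f x) powr r) powr (1 / r)"

definition linfnorm :: "nat \<Rightarrow> nat \<Rightarrow> ((nat \<Rightarrow> int) \<Rightarrow> complex) \<Rightarrow> real" where
  "linfnorm d N f = Max ((\<lambda>x. cmod (f x)) ` zmod_vec d N)"

definition supp :: "nat \<Rightarrow> nat \<Rightarrow> ((nat \<Rightarrow> int) \<Rightarrow> complex) \<Rightarrow> (nat \<Rightarrow> int) set" where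
  "supp d N f = {x \<in> zmod_vec d N. f x \<noteq> 0}"

text \<open>
  For nonempty \<open>S\<close> inside \<open>zmod_vec d N\<close> and \<open>r \<ge> 1\<close> the supremum is over a nonempty set of reals
  bounded above by 1, since the counting-measure sup norm is at most the \<open>r\<close>-norm. The condition
  that \<open>f\<close> is nonzero is expressed by nonemptiness of its support.
\<close>

definition synthesis_const :: "nat \<Rightarrow> nat \<Rightarrow> real \<Rightarrow> (nat \<Rightarrow> int) set \<Rightarrow> real" where
  "synthesis_const d N r S =
     Sup {linfnorm d N (fourier d N f) / lnorm d N r (fourier d N f) | f.
            supp d N f \<noteq> {} \<and> supp d N f \<subseteq> S}"

text \<open>
  \<open>M\<close> is the set of moduli over which the family \<open>S\<close> is indexed. The limit is taken as \<open>N\<close> tends to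
  infinity inside \<open>M\<close>.
\<close>

definition uniform_spectral_synthesis ::
  "nat \<Rightarrow> real \<Rightarrow> nat set \<Rightarrow> (nat \<Rightarrow> (nat \<Rightarrow> int) set) \<Rightarrow> bool" where
  "uniform_spectral_synthesis d r M S \<longleftrightarrow>
     (\<forall>f. (\<forall>N\<in>M. supp d N (f N) \<subseteq> S N) \<longrightarrow>
          bdd_above ((\<lambda>N. lnorm d N r (fourier d N (f N))) ` M) \<longrightarrow>
          ((\<lambda>N. linfnorm d N (fourier d N (f N))) \<longlongrightarrow> 0) (inf at_top (principal M)))"

text \<open>The coordinates are indexed from 0, so the last coordinate has index \<open>d - 1\<close>.\<close>

definition paraboloid :: "nat \<Rightarrow> nat \<Rightarrow> (nat \<Rightarrow> int) set" where
  "paraboloid d N =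
     (\<lambda>t. t(d - 1 := (\<Sum>i<d - 1. (t i)\<^sup>2) mod int N)) ` zmod_vec (d - 1) N"

definition critical_exponent :: "nat \<Rightarrow> real" where
  "critical_exponent d = 2 * real d / (real d - 1)"

end

theory Submission
  imports Defs "HOL-Number_Theory.Cong"
begin

text \<open>
  Let \<open>K\<close> be the Fourier transform of the density on the paraboloid with \<open>K 0 = 1\<close>. The affine maps
  \<open>(t, |t|\<^sup>2) \<mapsto> (t + b, |t + b|\<^sup>2)\<close> act transitively on the paraboloid and shear the frequencies; averaging
  the transform \<open>F\<close> of any supported function over them, after a translation of frequencies, gives
  \<open>F \<xi>\<^sub>0 * K\<close>. Convexity then yields \<open>|F \<xi>\<^sub>0| \<parallel>K\<parallel>\<^sub>r \<le> \<parallel>F\<parallel>\<^sub>r\<close>, so the synthesis constant is exactly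
  \<open>1 / \<parallel>K\<parallel>\<^sub>r\<close>. Since \<open>K\<close> is a product of normalized Gauss sums, whose moduli are known, \<open>\<parallel>K\<parallel>\<^sub>r\<close> is an
  explicit geometric sum, with ratio 1 at the critical exponent.
\<close>

subsection \<open>Characters and Gauss sums modulo N\<close>

definition chi :: "nat \<Rightarrow> int \<Rightarrow> complex" where
  "chi N z = cis (2 * pi * of_int z / of_nat N)"

lemma chi_0 [simp]: "chi N 0 = 1"
  by (simp add: chi_def)

lemma chi_add: "chi N (a + b) = chi N a * chi N b"
  by (simp add: chi_def cis_mult ring_distribs add_divide_distrib)

lemma chi_minus_add: "chi N (- (a + b)) = chi N (- a) * chi N (- b)"
  by (simp add: chi_add[symmetric])

lemma norm_chi [simp]: "cmod (chi N a) = 1"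
  by (simp add: chi_def)

lemma chi_minus: "chi N (- a) = cnj (chi N a)"
  by (simp add: chi_def cis_cnj)

lemma chi_sum: "chi N (\<Sum>i\<in>A. f i) = (\<Prod>i\<in>A. chi N (f i))"
  by (induction A rule: infinite_finite_induct) (simp_all add: chi_add)

lemma chi_eq_1_iff:
  assumes "N > 0"
  shows "chi N a = 1 \<longleftrightarrow> int N dvd a"
proof
  assume "chi N a = 1"
  then obtain n :: int where "2 * pi * of_int a / of_nat N = of_int n * (2 * pi)"
    unfolding chi_def by (auto simp: complex_eq_iff cos_one_2pi_int mult_ac)
  then have "real_of_int a = of_int (n * int N)"
    using assms by (simp add: field_simps)
  then show "int N dvd a"
    by (metis dvd_triv_right of_int_eq_iff)
next
  assume "int N dvd a"
  then obtain n where "a = int N * n" by blast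
  then have "2 * pi * of_int a / of_nat N = 2 * pi * of_int n"
    using assms by simp
  then show "chi N a = 1"
    by (simp add: chi_def)
qed

lemma chi_cong:
  assumes "N > 0" "[a = b] (mod int N)"
  shows "chi N a = chi N b"
proof -
  have "chi N (a - b) = 1"
    using assms by (simp add: chi_eq_1_iff cong_iff_dvd_diff)
  then show ?thesis
    using chi_add[of N "a - b" b] by simp
qed

text \<open>Translation permutes the residue classes. Since \<open>h\<close> is periodic, it may be
  evaluated at the unreduced \<open>x + c\<close>, so later computations never carry a
  \<open>mod\<close>.\<close>

lemma sum_residues_reindex:
  fixes h :: "int \<Rightarrow> 'b::comm_monoid_add"
  assumes "N > 0"
    and per: "\<And>x y. [x = y] (mod int N) \<Longrightarrow> h x = h y"
  shows "(\<Sum>x\<in>{0..<int N}. h (x + c)) = (\<Sum>x\<in>{0..<int N}. h x)"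
proof -
  let ?m = "\<lambda>x. (x + c) mod int N"
  have inj: "inj_on ?m {0..<int N}"
  proof (rule inj_onI)
    fix x y assume xy: "x \<in> {0..<int N}" "y \<in> {0..<int N}" "?m x = ?m y"
    then have "[x + c = y + c] (mod int N)" by (simp add: cong_def)
    then have "[x = y] (mod int N)" by (simp only: cong_add_rcancel)
    with xy show "x = y" by (simp add: cong_def)
  qed
  have "?m ` {0..<int N} = {0..<int N}"
    by (rule endo_inj_surj[OF _ _ inj]) (use assms in auto)
  then have "(\<Sum>x\<in>{0..<int N}. h x) = (\<Sum>x\<in>{0..<int N}. h (?m x))"
    using sum.reindex[OF inj, of h] by simp
  also have "\<dots> = (\<Sum>x\<in>{0..<int N}. h (x + c))"
    by (intro sum.cong refl per) (simp add: cong_def)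
  finally show ?thesis ..
qed

lemma sum_chi:
  assumes "N > 0"
  shows "(\<Sum>t\<in>{0..<int N}. chi N (a * t)) = (if int N dvd a then of_nat N else 0)"
proof (cases "int N dvd a")
  case True
  then have "chi N (a * t) = 1" for t
    using assms by (simp add: chi_eq_1_iff)
  with True show ?thesis by simp
next
  case False
  let ?S = "\<Sum>t\<in>{0..<int N}. chi N (a * t)"
  \<comment> \<open>Shifting the variable by 1 multiplies the sum by \<open>chi N a\<close>, which
    is not 1; hence the sum vanishes.\<close>
  have "?S = (\<Sum>t\<in>{0..<int N}. chi N (a * (t + 1)))"
    by (rule sum_residues_reindex[symmetric])
      (use assms in \<open>auto intro!: chi_cong cong_mult\<close>)
  also have "\<dots> = chi N a * ?S"
    by (simp add: sum_distrib_left distrib_left chi_add mult.commute)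
  finally have "?S * (1 - chi N a) = 0"
    by (simp add: algebra_simps)
  with False show ?thesis
    using chi_eq_1_iff[OF assms, of a] by auto
qed

text \<open>The multiples of \<open>q\<close> among the residues are \<open>q * s\<close> with
  \<open>s\<close> running through the residues modulo the cofactor \<open>g\<close>. This evaluates
  every sum that a divisibility condition has cut down.\<close>

lemma sum_residues_dvd:
  fixes f :: "int \<Rightarrow> 'b::semiring_1"
  assumes "q > 0" "g > 0" and N: "N = q * g"
  shows "(\<Sum>x\<in>{0..<int N}. if int q dvd x then f x else 0) = (\<Sum>s\<in>{0..<int g}. f (int q * s))"
proof -
  have "(\<Sum>x\<in>{0..<int N}. if int q dvd x then f x else 0)
      = (\<Sum>x\<in>{x\<in>{0..<int N}. int q dvd x}. f x)"
    by (rule sum.inter_filter[symmetric]) simp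
  also have "{x\<in>{0..<int N}. int q dvd x} = (\<lambda>s. int q * s) ` {0..<int g}"
  proof (intro equalityI subsetI)
    fix x assume "x \<in> {x\<in>{0..<int N}. int q dvd x}"
    then obtain s where s: "x = int q * s" "0 \<le> x" "x < int q * int g"
      using N by auto
    then have "s \<in> {0..<int g}"
      using assms by (auto simp: zero_le_mult_iff)
    with s show "x \<in> (\<lambda>s. int q * s) ` {0..<int g}" by blast
  qed (use assms in auto)
  also have "(\<Sum>x\<in>\<dots>. f x) = (\<Sum>s\<in>{0..<int g}. f (int q * s))"
    using assms by (subst sum.reindex) (auto simp: inj_on_def)
  finally show ?thesis .
qed

section \<open>Moduli of quadratic Gauss sums with arbitrary coefficients\<close>

definition gauss :: "nat \<Rightarrow> int \<Rightarrow> int \<Rightarrow> complex" where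
  "gauss N a b = (\<Sum>t\<in>{0..<int N}. chi N (- (t * a + t\<^sup>2 * b)))"

text \<open>Weyl differencing: in the double sum for the squared modulus, replacing \<open>s\<close>
  by \<open>s + t\<close> makes the phase linear in \<open>t\<close>. Orthogonality then keeps only
  the multiples of \<open>q = N / gcd(b, N)\<close>, on which the quadratic phase is trivial, and a
  second use of orthogonality tests whether the gcd divides \<open>a\<close>.\<close>

lemma norm_gauss_square:
  assumes N: "N > 0" "odd N"
  defines "g \<equiv> \<lambda>b. nat (gcd b (int N))"
  shows "(cmod (gauss N a b))\<^sup>2 = (if int (g b) dvd a then real N * real (g b) else 0)"
proof -
  define G where "G = g b"
  define q where "q = N div G"
  have G: "int G = gcd b (int N)"
    by (simp add: G_def g_def)
  then have G0: "G > 0"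
    using N by (metis gcd_pos_int int_nat_eq of_nat_0_less_iff of_nat_0_eq_iff neq0_conv)
  have "int G dvd int N" using G by simp
  then have NqG: "N = q * G" by (simp add: q_def)
  then have q0: "q > 0" using N by auto
  obtain b' where b': "b = int G * b'"
    using G by (metis dvd_def gcd_dvd1)
  have cop: "coprime b' (int q)"
  proof -
    have "int G * gcd b' (int q) = gcd b (int N)"
      using gcd_mult_distrib_int[of "int G" b' "int q"] by (simp add: NqG b' mult_ac)
    with G G0 N show ?thesis by (auto simp: coprime_iff_gcd_eq_1)
  qed
  \<comment> \<open>Oddness of \<open>N\<close> enters here: both 2 and \<open>b'\<close> are
    invertible modulo \<open>q\<close>.\<close>
  have dvd_iff: "int N dvd 2 * b * h \<longleftrightarrow> int q dvd h" for h
  proof -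
    have "int N dvd 2 * b * h \<longleftrightarrow> int G * int q dvd int G * (2 * b' * h)"
      by (simp add: NqG b' mult_ac)
    also have "\<dots> \<longleftrightarrow> int q dvd (2 * b') * h" using G0 by simp
    also have "\<dots> \<longleftrightarrow> int q dvd h"
    proof (rule coprime_dvd_mult_right_iff)
      have "odd q" using N NqG by simp
      then have "coprime (int q) 2" by simp
      then show "coprime (int q) (2 * b')" using cop by (simp add: coprime_commute)
    qed
    finally show ?thesis .
  qed
  have "complex_of_real ((cmod (gauss N a b))\<^sup>2) = gauss N a b * cnj (gauss N a b)"
    by (rule complex_norm_square)
  also have "\<dots> = (\<Sum>t\<in>{0..<int N}. \<Sum>s\<in>{0..<int N}.
                    chi N (- (t * a + t\<^sup>2 * b)) * chi N (s * a + s\<^sup>2 * b))"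
    by (simp add: gauss_def sum_product add.commute flip: chi_minus)
  also have "\<dots> = (\<Sum>t\<in>{0..<int N}. \<Sum>s\<in>{0..<int N}.
                    chi N (- (t * a + t\<^sup>2 * b)) * chi N ((s + t) * a + (s + t)\<^sup>2 * b))"
    by (intro sum.cong refl sum_residues_reindex[symmetric])
      (use N in \<open>auto intro!: chi_cong cong_mult cong_add cong_pow\<close>)
  \<comment> \<open>The terms \<open>t * a\<close> and \<open>t^2 * b\<close> cancel; only the cross
    term \<open>2 * b * s * t\<close> still involves \<open>t\<close>.\<close>
  also have "\<dots> = (\<Sum>t\<in>{0..<int N}. \<Sum>s\<in>{0..<int N}.
                    chi N (s * a + s\<^sup>2 * b) * chi N (2 * b * s * t))"
    unfolding chi_add[symmetric]
    by (intro sum.cong refl arg_cong[of _ _ "chi N"]) (simp add: algebra_simps power2_eq_square)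
  also have "\<dots> = (\<Sum>s\<in>{0..<int N}. chi N (s * a + s\<^sup>2 * b) *
                    (\<Sum>t\<in>{0..<int N}. chi N (2 * b * s * t)))"
    by (subst sum.swap) (simp add: sum_distrib_left)
  also have "\<dots> = (\<Sum>s\<in>{0..<int N}. if int q dvd s then chi N (s * a + s\<^sup>2 * b) * of_nat N else 0)"
    using N by (intro sum.cong refl) (simp add: sum_chi dvd_iff)
  also have "\<dots> = (\<Sum>s\<in>{0..<int G}. chi N (int q * s * a + (int q * s)\<^sup>2 * b) * of_nat N)"
    by (rule sum_residues_dvd) (use q0 G0 NqG in auto)
  also have "\<dots> = (\<Sum>s\<in>{0..<int G}. chi G (a * s) * of_nat N)"
  proof (intro sum.cong refl)
    fix s
    have "chi N ((int q * s)\<^sup>2 * b) = 1"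
      using N by (subst chi_eq_1_iff) (auto simp: NqG b' power2_eq_square)
    moreover have "chi N (int q * s * a) = chi G (a * s)"
      using q0 by (simp add: chi_def NqG mult_ac)
    ultimately show "chi N (int q * s * a + (int q * s)\<^sup>2 * b) * of_nat N = chi G (a * s) * of_nat N"
      by (simp add: chi_add)
  qed
  also have "\<dots> = (if int G dvd a then of_nat G else 0) * of_nat N"
    using G0 by (simp add: sum_chi flip: sum_distrib_right)
  also have "\<dots> = complex_of_real (if int G dvd a then real N * real G else 0)"
    by simp
  finally show ?thesis
    unfolding G_def of_real_eq_iff .
qed

subsection \<open>Vectors over the residues\<close>

lemma finite_zmod_vec [simp]: "finite (zmod_vec d N)"
  by (simp add: zmod_vec_def finite_PiE)

lemma card_zmod_vec [simp]: "card (zmod_vec d N) = N ^ d"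
  by (simp add: zmod_vec_def card_PiE)

lemma zmod_vec_nonempty:
  assumes "N > 0"
  shows "zmod_vec d N \<noteq> {}"
  using assms card_zmod_vec[of d N] by (metis card.empty power_not_zero neq0_conv)

lemma zmod_vec_eqI:
  assumes "x \<in> zmod_vec d N" "y \<in> zmod_vec d N"
    and "\<And>i. i < d \<Longrightarrow> [x i = y i] (mod int N)"
  shows "x = y"
proof (rule PiE_ext)
  show "x \<in> {..<d} \<rightarrow>\<^sub>E {0..<int N}" "y \<in> {..<d} \<rightarrow>\<^sub>E {0..<int N}"
    using assms by (simp_all add: zmod_vec_def)
  fix i assume i: "i \<in> {..<d}"
  then have "x i \<in> {0..<int N}" "y i \<in> {0..<int N}"
    using assms(1,2) PiE_mem[of x "{..<d}" "\<lambda>_. {0..<int N}" i]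
      PiE_mem[of y "{..<d}" "\<lambda>_. {0..<int N}" i] unfolding zmod_vec_def by simp_all
  with assms(3)[of i] i show "x i = y i" by (simp add: cong_def)
qed

text \<open>An injective self-map of a finite set is a bijection. The map \<open>\<tau>\<close> acts
  on unreduced integer vectors and need only be injective modulo \<open>N\<close>, so it can be a
  translation or a shear given by its plain formula.\<close>

lemma sum_zmod_vec_reindex:
  fixes h :: "(nat \<Rightarrow> int) \<Rightarrow> 'b::comm_monoid_add"
  assumes N: "N > 0"
    and per: "\<And>x y. (\<And>i. i < d \<Longrightarrow> [x i = y i] (mod int N)) \<Longrightarrow> h x = h y"
    and inj: "\<And>x y i. \<lbrakk>\<And>i. i < d \<Longrightarrow> [\<tau> x i = \<tau> y i] (mod int N); i < d\<rbrakk> \<Longrightarrow> [x i = y i] (mod int N)"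
  shows "(\<Sum>x\<in>zmod_vec d N. h (\<tau> x)) = (\<Sum>x\<in>zmod_vec d N. h x)"
proof -
  let ?m = "\<lambda>x. \<lambda>i\<in>{..<d}. \<tau> x i mod int N"
  have inj_m: "inj_on ?m (zmod_vec d N)"
  proof (rule inj_onI)
    fix x y assume xy: "x \<in> zmod_vec d N" "y \<in> zmod_vec d N" "?m x = ?m y"
    have "[\<tau> x i = \<tau> y i] (mod int N)" if "i < d" for i
      using fun_cong[OF xy(3), of i] that by (simp add: cong_def)
    then show "x = y"
      by (intro zmod_vec_eqI[OF xy(1,2)] inj[of x y])
  qed
  have "?m x \<in> zmod_vec d N" for x
    unfolding zmod_vec_def restrict_PiE_iff using N by simp
  then have "?m ` zmod_vec d N = zmod_vec d N"
    by (intro endo_inj_surj inj_m image_subsetI finite_zmod_vec)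
  then have "(\<Sum>x\<in>zmod_vec d N. h x) = (\<Sum>x\<in>zmod_vec d N. h (?m x))"
    using sum.reindex[OF inj_m, of h] by simp
  also have "\<dots> = (\<Sum>x\<in>zmod_vec d N. h (\<tau> x))"
    by (intro sum.cong refl per) (simp add: cong_def)
  finally show ?thesis ..
qed

lemma sum_zmod_vec_Suc:
  fixes h :: "(nat \<Rightarrow> int) \<Rightarrow> 'b::comm_monoid_add"
  shows "(\<Sum>x\<in>zmod_vec (Suc n) N. h x) = (\<Sum>b\<in>{0..<int N}. \<Sum>y\<in>zmod_vec n N. h (y(n := b)))"
proof -
  have "zmod_vec (Suc n) N = (\<lambda>(b, y). y(n := b)) ` ({0..<int N} \<times> zmod_vec n N)"
    using PiE_insert_eq[of n "{..<n}" "\<lambda>_. {0..<int N}"] by (simp add: zmod_vec_def lessThan_Suc)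
  moreover have "inj_on (\<lambda>(b, y). y(n := b)) ({0..<int N} \<times> zmod_vec n N)"
    unfolding zmod_vec_def by (rule inj_combinator) simp
  ultimately show ?thesis
    by (simp add: sum.reindex sum.cartesian_product case_prod_unfold)
qed

text \<open>The pairing of a frequency \<open>\<xi>\<close> with the point
  \<open>(t, |t|^2)\<close>, before reduction: the last frequency multiplies every square.\<close>

definition quad :: "nat \<Rightarrow> (nat \<Rightarrow> int) \<Rightarrow> (nat \<Rightarrow> int) \<Rightarrow> int" where
  "quad n \<xi> t = (\<Sum>i<n. t i * \<xi> i + (t i)\<^sup>2 * \<xi> n)"

lemma quad_add: "quad n (\<lambda>i. \<xi> i + \<zeta> i) t = quad n \<xi> t + quad n \<zeta> t"
  unfolding quad_def sum.distrib[symmetric] by (intro sum.cong refl) (simp add: algebra_simps)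

text \<open>The action on frequencies dual to \<open>t \<mapsto> t + b\<close>: expanding the
  squares gives cross terms \<open>2 * b i * \<xi> n * t i\<close>, which are absorbed into the
  linear coefficients.\<close>

definition shear :: "nat \<Rightarrow> (nat \<Rightarrow> int) \<Rightarrow> (nat \<Rightarrow> int) \<Rightarrow> nat \<Rightarrow> int" where
  "shear n b \<xi> = (\<lambda>i. if i < n then \<xi> i + 2 * b i * \<xi> n else \<xi> i)"

lemma quad_translate: "quad n \<xi> (\<lambda>i. t i + b i) = quad n \<xi> b + quad n (shear n b \<xi>) t"
  unfolding quad_def shear_def sum.distrib[symmetric]
  by (intro sum.cong refl) (simp add: algebra_simps power2_eq_square)

lemma quad_cong:
  assumes "\<And>i. i \<le> n \<Longrightarrow> [\<xi> i = \<zeta> i] (mod m)" "\<And>i. i < n \<Longrightarrow> [t i = s i] (mod m)"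
  shows "[quad n \<xi> t = quad n \<zeta> s] (mod m)"
  unfolding quad_def by (intro cong_sum cong_add cong_mult cong_pow assms) auto

subsection \<open>Extremality of the kernel\<close>

text \<open>The unnormalized Fourier extension operator of the paraboloid, with the density written
  in the parameter \<open>t\<close>. For \<open>g = 1\<close> it is the kernel times
  \<open>N^n\<close>.\<close>

definition ext_sum :: "nat \<Rightarrow> nat \<Rightarrow> ((nat \<Rightarrow> int) \<Rightarrow> complex) \<Rightarrow> (nat \<Rightarrow> int) \<Rightarrow> complex" where
  "ext_sum n N g \<xi> = (\<Sum>t\<in>zmod_vec n N. g t * chi N (- quad n \<xi> t))"

lemma ext_sum_cong:
  assumes "N > 0" "\<And>i. i < Suc n \<Longrightarrow> [\<xi> i = \<zeta> i] (mod int N)"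
  shows "ext_sum n N g \<xi> = ext_sum n N g \<zeta>"
  unfolding ext_sum_def using assms
  by (intro sum.cong refl arg_cong2[of _ _ _ _ "(*)"] chi_cong)
    (auto simp: cong_minus_minus_iff intro!: quad_cong)

text \<open>For each \<open>t\<close> in the first factor, the complete sum over \<open>b\<close> in
  the second may be translated by \<open>t\<close>. The phase at \<open>t + b\<close> splits into
  the phase at \<open>b\<close> and a sheared phase at \<open>t\<close>; the latter merges with the
  phase of \<open>\<xi>\<^sub>0\<close>, and exchanging the sums gives the claim.\<close>

lemma ext_sum_average:
  assumes N: "N > 0"
  shows "ext_sum n N g \<xi>\<^sub>0 * ext_sum n N (\<lambda>_. 1) \<xi> =
    (\<Sum>b\<in>zmod_vec n N. chi N (- quad n \<xi> b) * ext_sum n N g (\<lambda>i. \<xi>\<^sub>0 i + shear n b \<xi> i))"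
proof -
  have translate: "(\<Sum>b\<in>zmod_vec n N. chi N (- quad n \<xi> (\<lambda>i. t i + b i)))
      = (\<Sum>b\<in>zmod_vec n N. chi N (- quad n \<xi> b))" for t
  proof (rule sum_zmod_vec_reindex[OF N, of n "\<lambda>b. chi N (- quad n \<xi> b)" "\<lambda>b i. t i + b i"])
    fix x y :: "nat \<Rightarrow> int"
    assume "\<And>i. i < n \<Longrightarrow> [x i = y i] (mod int N)"
    then show "chi N (- quad n \<xi> x) = chi N (- quad n \<xi> y)"
      by (intro chi_cong N) (auto simp: cong_minus_minus_iff intro!: quad_cong)
  qed (simp add: cong_add_lcancel)
  have "ext_sum n N g \<xi>\<^sub>0 * ext_sum n N (\<lambda>_. 1) \<xi> =
    (\<Sum>t\<in>zmod_vec n N. g t * chi N (- quad n \<xi>\<^sub>0 t) * (\<Sum>b\<in>zmod_vec n N. chi N (- quad n \<xi> b)))"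
    by (simp add: ext_sum_def sum_distrib_right)
  also have "\<dots> = (\<Sum>t\<in>zmod_vec n N. g t * chi N (- quad n \<xi>\<^sub>0 t) *
      (\<Sum>b\<in>zmod_vec n N. chi N (- quad n \<xi> (\<lambda>i. t i + b i))))"
    by (simp only: translate)
  also have "\<dots> = (\<Sum>t\<in>zmod_vec n N. \<Sum>b\<in>zmod_vec n N.
      chi N (- quad n \<xi> b) * (g t * chi N (- quad n (\<lambda>i. \<xi>\<^sub>0 i + shear n b \<xi> i) t)))"
    by (simp add: sum_distrib_left quad_translate quad_add chi_minus_add mult_ac del: minus_add_distrib)
  also have "\<dots> = (\<Sum>b\<in>zmod_vec n N. chi N (- quad n \<xi> b) * ext_sum n N g (\<lambda>i. \<xi>\<^sub>0 i + shear n b \<xi> i))"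
    by (subst sum.swap) (simp add: ext_sum_def sum_distrib_left)
  finally show ?thesis .
qed

lemma convex_on_powr_nonneg:
  fixes r :: real
  assumes "r \<ge> 1"
  shows "convex_on {0..} (\<lambda>x. x powr r)"
proof (rule convex_on_linorderI)
  fix t x y :: real
  assume t: "0 < t" "t < 1" and xy: "x \<in> {0..}" "y \<in> {0..}" "x < y"
  show "((1 - t) *\<^sub>R x + t *\<^sub>R y) powr r \<le> (1 - t) * x powr r + t * y powr r"
  proof (cases "x = 0")
    \<comment> \<open>At the boundary point the claim reduces to \<open>t powr r \<le> t\<close>,
      because \<open>0 powr r = 0\<close>. Zero must be covered because exponential sums can
      vanish.\<close>
    case True
    have "t powr r \<le> t powr 1"
      using t assms by (intro powr_mono') auto
    with True t xy show ?thesis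
      by (auto simp: powr_mult intro!: mult_right_mono)
  next
    case False
    with xy t convex_onD[OF powr_convex[OF assms], of t x y] show ?thesis by simp
  qed
qed simp

lemma powr_average_le:
  fixes y :: "'a \<Rightarrow> real"
  assumes "finite B" "B \<noteq> {}" "r \<ge> 1" "\<And>b. b \<in> B \<Longrightarrow> y b \<ge> 0"
  shows "((\<Sum>b\<in>B. y b) / card B) powr r \<le> (\<Sum>b\<in>B. y b powr r) / card B"
  using convex_on_sum[OF assms(1,2) convex_on_powr_nonneg[OF assms(3)], of "\<lambda>_. 1 / card B" y] assms
  by (simp add: card_gt_0_iff sum_divide_distrib)

text \<open>The \<open>r\<close>-th power of the \<open>r\<close>-norm of the kernel; division by
  \<open>N^n\<close> makes the kernel 1 at the origin.\<close>

definition kernel_mass :: "nat \<Rightarrow> nat \<Rightarrow> real \<Rightarrow> real" where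
  "kernel_mass n N r = (\<Sum>\<xi>\<in>zmod_vec (Suc n) N. (cmod (ext_sum n N (\<lambda>_. 1) \<xi>) / real N ^ n) powr r)"

text \<open>The triangle inequality in \<open>ext_sum_average\<close>, whose weights have modulus 1,
  bounds the product by an average over \<open>b\<close>. Jensen's inequality moves the power
  inside. After summing over \<open>\<xi>\<close>, every \<open>b\<close> contributes the same full
  sum, since shear plus translation permutes the frequencies.\<close>

lemma kernel_mass_extremal:
  assumes N: "N > 0" and r: "r \<ge> 1"
  shows "cmod (ext_sum n N g \<xi>\<^sub>0) powr r * kernel_mass n N r
    \<le> (\<Sum>\<xi>\<in>zmod_vec (Suc n) N. cmod (ext_sum n N g \<xi>) powr r)"
proof -
  let ?Z = "zmod_vec n N" and ?V = "zmod_vec (Suc n) N" and ?M = "real N ^ n"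
  let ?y = "\<lambda>b \<xi>. cmod (ext_sum n N g (\<lambda>i. \<xi>\<^sub>0 i + shear n b \<xi> i))"
  have M: "?M = real (card ?Z)" by simp
  have bound: "cmod (ext_sum n N g \<xi>\<^sub>0) * (cmod (ext_sum n N (\<lambda>_. 1) \<xi>) / ?M)
      \<le> (\<Sum>b\<in>?Z. ?y b \<xi>) / ?M" for \<xi>
  proof -
    have "cmod (ext_sum n N g \<xi>\<^sub>0 * ext_sum n N (\<lambda>_. 1) \<xi>) \<le> (\<Sum>b\<in>?Z. ?y b \<xi>)"
      unfolding ext_sum_average[OF N] by (rule sum_norm_le) (simp add: norm_mult)
    then show ?thesis by (simp add: norm_mult divide_right_mono)
  qed
  have shift: "(\<Sum>\<xi>\<in>?V. ?y b \<xi> powr r) = (\<Sum>\<xi>\<in>?V. cmod (ext_sum n N g \<xi>) powr r)" for b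
  proof (rule sum_zmod_vec_reindex[of N "Suc n" "\<lambda>\<xi>. cmod (ext_sum n N g \<xi>) powr r"
        "\<lambda>\<xi> i. \<xi>\<^sub>0 i + shear n b \<xi> i"])
    fix x y :: "nat \<Rightarrow> int" and i
    assume *: "\<And>i. i < Suc n \<Longrightarrow> [\<xi>\<^sub>0 i + shear n b x i = \<xi>\<^sub>0 i + shear n b y i] (mod int N)"
      and i: "i < Suc n"
    \<comment> \<open>The shear fixes the last coordinate, so that congruence comes first; it then
      allows the cross terms in the other coordinates to be cancelled.\<close>
    have n: "[x n = y n] (mod int N)"
      using *[of n] by (simp add: shear_def cong_add_lcancel)
    show "[x i = y i] (mod int N)"
    proof (cases "i = n")
      case False
      then have "[x i + 2 * b i * x n = y i + 2 * b i * y n] (mod int N)"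
        using *[OF i] i by (simp add: shear_def cong_add_lcancel)
      moreover have "[2 * b i * x n = 2 * b i * y n] (mod int N)"
        using n by (intro cong_mult) auto
      ultimately show ?thesis
        using cong_diff[of "x i + 2 * b i * x n" "y i + 2 * b i * y n" "int N"
            "2 * b i * x n" "2 * b i * y n"] by simp
    qed (use n in simp)
  next
    fix x y :: "nat \<Rightarrow> int"
    assume "\<And>i. i < Suc n \<Longrightarrow> [x i = y i] (mod int N)"
    then show "cmod (ext_sum n N g x) powr r = cmod (ext_sum n N g y) powr r"
      using ext_sum_cong[OF N] by metis
  qed (use N in simp)
  have "cmod (ext_sum n N g \<xi>\<^sub>0) powr r * kernel_mass n N r
      = (\<Sum>\<xi>\<in>?V. (cmod (ext_sum n N g \<xi>\<^sub>0) * (cmod (ext_sum n N (\<lambda>_. 1) \<xi>) / ?M)) powr r)"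
    by (simp add: kernel_mass_def sum_distrib_left powr_mult flip: times_divide_eq_right)
  also have "\<dots> \<le> (\<Sum>\<xi>\<in>?V. ((\<Sum>b\<in>?Z. ?y b \<xi>) / ?M) powr r)"
    using bound r by (intro sum_mono powr_mono2) auto
  also have "\<dots> \<le> (\<Sum>\<xi>\<in>?V. (\<Sum>b\<in>?Z. ?y b \<xi> powr r) / ?M)"
    unfolding M by (intro sum_mono powr_average_le) (use r zmod_vec_nonempty[OF N] in auto)
  also have "\<dots> = (\<Sum>b\<in>?Z. \<Sum>\<xi>\<in>?V. ?y b \<xi> powr r) / ?M"
    by (subst sum.swap) (simp add: sum_divide_distrib)
  also have "\<dots> = (\<Sum>\<xi>\<in>?V. cmod (ext_sum n N g \<xi>) powr r)"
    using N by (simp add: shift)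
  finally show ?thesis .
qed

section \<open>Functions on the paraboloid and the exact synthesis constant\<close>

definition lift_parab :: "nat \<Rightarrow> nat \<Rightarrow> (nat \<Rightarrow> int) \<Rightarrow> nat \<Rightarrow> int" where
  "lift_parab n N t = t(n := (\<Sum>i<n. (t i)\<^sup>2) mod int N)"

lemma paraboloid_Suc: "paraboloid (Suc n) N = lift_parab n N ` zmod_vec n N"
  by (simp add: paraboloid_def lift_parab_def)

lemma inj_on_lift_parab: "inj_on (lift_parab n N) (zmod_vec n N)"
proof (rule inj_onI)
  fix x y assume xy: "x \<in> zmod_vec n N" "y \<in> zmod_vec n N" "lift_parab n N x = lift_parab n N y"
  show "x = y"
  proof (rule zmod_vec_eqI[OF xy(1,2)])
    fix i assume "i < n"
    then show "[x i = y i] (mod int N)"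
      using fun_cong[OF xy(3), of i] by (simp add: lift_parab_def)
  qed
qed

lemma paraboloid_subset:
  assumes "N > 0"
  shows "paraboloid (Suc n) N \<subseteq> zmod_vec (Suc n) N"
proof -
  have "lift_parab n N t \<in> zmod_vec (Suc n) N" if "t \<in> zmod_vec n N" for t
    using that assms unfolding zmod_vec_def lift_parab_def lessThan_Suc by (intro PiE_fun_upd) auto
  then show ?thesis
    by (auto simp: paraboloid_Suc)
qed

text \<open>Parametrizing the support by \<open>t\<close> turns the transform into an extension sum;
  the reduction modulo \<open>N\<close> of the last coordinate is invisible to the
  character.\<close>

lemma fourier_paraboloid:
  assumes N: "N > 0" and f: "supp (Suc n) N f \<subseteq> paraboloid (Suc n) N"
  shows "fourier (Suc n) N f \<xi> =
    complex_of_real (real N powr (- real (Suc n) / 2)) * ext_sum n N (\<lambda>t. f (lift_parab n N t)) \<xi>"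
proof -
  let ?e = "\<lambda>x. exp (- 2 * complex_of_real pi * \<i> * of_int (\<Sum>i<Suc n. x i * \<xi> i) / of_nat N)"
  have "exp (- 2 * complex_of_real pi * \<i> * of_int z / of_nat N) = chi N (- z)" for z
    unfolding chi_def cis_conv_exp by (rule arg_cong[of _ _ exp]) (simp add: mult_ac)
  then have e: "?e x = chi N (- (\<Sum>i<Suc n. x i * \<xi> i))" for x .
  have e_lift: "chi N (- (\<Sum>i<Suc n. lift_parab n N t i * \<xi> i)) = chi N (- quad n \<xi> t)" for t
  proof (rule chi_cong[OF N])
    have "[(\<Sum>i<n. t i * \<xi> i) + ((\<Sum>i<n. (t i)\<^sup>2) mod int N) * \<xi> n
        = (\<Sum>i<n. t i * \<xi> i) + (\<Sum>i<n. (t i)\<^sup>2) * \<xi> n] (mod int N)"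
      by (intro cong_add cong_mult cong_refl) (simp add: cong_def)
    then have "[(\<Sum>i<Suc n. lift_parab n N t i * \<xi> i) = quad n \<xi> t] (mod int N)"
      by (simp add: lift_parab_def quad_def sum.distrib sum_distrib_right)
    then show "[- (\<Sum>i<Suc n. lift_parab n N t i * \<xi> i) = - quad n \<xi> t] (mod int N)"
      by (simp only: cong_minus_minus_iff)
  qed
  have "(\<Sum>x\<in>zmod_vec (Suc n) N. f x * ?e x) = (\<Sum>x\<in>paraboloid (Suc n) N. f x * ?e x)"
    using f paraboloid_subset[OF N] by (intro sum.mono_neutral_right) (auto simp: supp_def)
  also have "\<dots> = ext_sum n N (\<lambda>t. f (lift_parab n N t)) \<xi>"
    unfolding paraboloid_Suc ext_sum_def by (subst sum.reindex[OF inj_on_lift_parab]) (simp only: o_def e e_lift)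
  finally show ?thesis
    by (simp add: fourier_def)
qed

text \<open>The zero frequency, restricted because members of \<open>zmod_vec\<close> are
  extensional.\<close>

definition zvec :: "nat \<Rightarrow> nat \<Rightarrow> int" where
  "zvec d = (\<lambda>i\<in>{..<d}. 0)"

lemma zvec_mem: "N > 0 \<Longrightarrow> zvec d \<in> zmod_vec d N"
  by (simp add: zvec_def zmod_vec_def)

lemma ext_sum_zvec: "ext_sum n N g (zvec (Suc n)) = (\<Sum>t\<in>zmod_vec n N. g t)"
  by (simp add: ext_sum_def quad_def zvec_def)

text \<open>The origin alone contributes 1. This supplies the positivity needed for negative powers
  of the mass.\<close>

lemma kernel_mass_ge_1:
  assumes "N > 0"
  shows "kernel_mass n N r \<ge> 1"
proof -
  have "1 = (cmod (ext_sum n N (\<lambda>_. 1) (zvec (Suc n))) / real N ^ n) powr r"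
    using assms by (simp add: ext_sum_zvec norm_power)
  also have "\<dots> \<le> kernel_mass n N r"
    unfolding kernel_mass_def by (rule member_le_sum) (use zvec_mem[OF assms] in auto)
  finally show ?thesis .
qed

text \<open>Apply \<open>kernel_mass_extremal\<close> at a frequency where the maximum is attained
  and take \<open>r\<close>-th roots; the unitary factor scales both sides equally. The product form
  also covers \<open>f = 0\<close>, as the synthesis property requires.\<close>

lemma linfnorm_fourier_le:
  assumes N: "N > 0" and r: "r \<ge> 1" and f: "supp (Suc n) N f \<subseteq> paraboloid (Suc n) N"
  shows "linfnorm (Suc n) N (fourier (Suc n) N f)
    \<le> kernel_mass n N r powr (- 1 / r) * lnorm (Suc n) N r (fourier (Suc n) N f)"
proof -
  let ?V = "zmod_vec (Suc n) N" and ?F = "fourier (Suc n) N f" and ?m = "kernel_mass n N r"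
  define c where "c = real N powr (- real (Suc n) / 2)"
  define g where "g = (\<lambda>t. f (lift_parab n N t))"
  have c: "c > 0" using N by (simp add: c_def)
  have F: "cmod (?F \<xi>) = c * cmod (ext_sum n N g \<xi>)" for \<xi>
    using c fourier_paraboloid[OF N f, of \<xi>] unfolding c_def[symmetric] g_def[symmetric]
    by (simp add: norm_mult)
  have m: "?m > 0" using kernel_mass_ge_1[OF N, of n r] by simp
  have "linfnorm (Suc n) N ?F \<in> (\<lambda>x. cmod (?F x)) ` ?V"
    unfolding linfnorm_def using zmod_vec_nonempty[OF N] by (intro Max_in) auto
  then obtain \<xi>\<^sub>0 where \<xi>\<^sub>0: "linfnorm (Suc n) N ?F = cmod (?F \<xi>\<^sub>0)" by auto
  have "cmod (?F \<xi>\<^sub>0) powr r * ?m \<le> (\<Sum>\<xi>\<in>?V. cmod (?F \<xi>) powr r)"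
  proof -
    have "cmod (?F \<xi>\<^sub>0) powr r * ?m = c powr r * (cmod (ext_sum n N g \<xi>\<^sub>0) powr r * ?m)"
      using c by (simp add: F powr_mult)
    also have "\<dots> \<le> c powr r * (\<Sum>\<xi>\<in>?V. cmod (ext_sum n N g \<xi>) powr r)"
      using kernel_mass_extremal[OF N r, of n g \<xi>\<^sub>0] by (intro mult_left_mono) auto
    also have "\<dots> = (\<Sum>\<xi>\<in>?V. cmod (?F \<xi>) powr r)"
      using c by (simp add: F powr_mult sum_distrib_left)
    finally show ?thesis .
  qed
  then have "(cmod (?F \<xi>\<^sub>0) powr r * ?m) powr (1 / r) \<le> lnorm (Suc n) N r ?F"
    unfolding lnorm_def using m r by (intro powr_mono2) auto
  also have "(cmod (?F \<xi>\<^sub>0) powr r * ?m) powr (1 / r) = cmod (?F \<xi>\<^sub>0) * ?m powr (1 / r)"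
    using m r by (simp add: powr_mult powr_powr)
  finally have "?m powr (- 1 / r) * (cmod (?F \<xi>\<^sub>0) * ?m powr (1 / r)) \<le> ?m powr (- 1 / r) * lnorm (Suc n) N r ?F"
    by (intro mult_left_mono) auto
  moreover have "?m powr (- 1 / r) * ?m powr (1 / r) = 1"
    using m by (simp flip: powr_add)
  ultimately show ?thesis
    by (simp add: \<xi>\<^sub>0 mult_ac)
qed

text \<open>The density on the paraboloid whose Fourier transform is the kernel, with value 1 at the origin.\<close>

definition unit_density :: "nat \<Rightarrow> nat \<Rightarrow> (nat \<Rightarrow> int) \<Rightarrow> complex" where
  "unit_density n N x = (if x \<in> paraboloid (Suc n) N
     then complex_of_real (real N powr (real (Suc n) / 2) / real N ^ n) else 0)"

lemma supp_unit_density: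
  assumes "N > 0"
  shows "supp (Suc n) N (unit_density n N) = paraboloid (Suc n) N"
  using assms paraboloid_subset[OF assms, of n] by (auto simp: supp_def unit_density_def)

lemma cmod_fourier_unit_density:
  assumes N: "N > 0"
  shows "cmod (fourier (Suc n) N (unit_density n N) \<xi>) = cmod (ext_sum n N (\<lambda>_. 1) \<xi>) / real N ^ n"
proof -
  define c where "c = real N powr (real (Suc n) / 2)"
  have c: "c > 0" using N by (simp add: c_def)
  have "ext_sum n N (\<lambda>t. unit_density n N (lift_parab n N t)) \<xi>
      = complex_of_real (c / real N ^ n) * ext_sum n N (\<lambda>_. 1) \<xi>"
    unfolding ext_sum_def sum_distrib_left
    by (intro sum.cong refl) (simp add: unit_density_def paraboloid_Suc c_def)
  moreover have "real N powr (- real (Suc n) / 2) = 1 / c"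
    using powr_minus_divide[of "real N" "real (Suc n) / 2"] by (simp only: c_def minus_divide_left)
  ultimately show ?thesis
    using c supp_unit_density[OF N, of n]
    by (simp add: fourier_paraboloid[OF N] norm_mult norm_divide norm_power del: of_nat_Suc)
qed

lemma lnorm_fourier_unit_density:
  assumes "N > 0"
  shows "lnorm (Suc n) N r (fourier (Suc n) N (unit_density n N)) = kernel_mass n N r powr (1 / r)"
  by (simp add: lnorm_def kernel_mass_def cmod_fourier_unit_density[OF assms])

lemma linfnorm_fourier_unit_density:
  assumes N: "N > 0"
  shows "linfnorm (Suc n) N (fourier (Suc n) N (unit_density n N)) = 1"
  unfolding linfnorm_def cmod_fourier_unit_density[OF N]
proof (rule Max_eqI)
  fix y assume "y \<in> (\<lambda>x. cmod (ext_sum n N (\<lambda>_. 1) x) / real N ^ n) ` zmod_vec (Suc n) N"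
  then obtain \<xi> where y: "y = cmod (ext_sum n N (\<lambda>_. 1) \<xi>) / real N ^ n" by auto
  have "cmod (ext_sum n N (\<lambda>_. 1) \<xi>) \<le> (\<Sum>t\<in>zmod_vec n N. 1)"
    unfolding ext_sum_def by (rule sum_norm_le) simp
  with N y show "y \<le> 1" by (simp add: divide_le_eq)
next
  have "1 = cmod (ext_sum n N (\<lambda>_. 1) (zvec (Suc n))) / real N ^ n"
    using N by (simp add: ext_sum_zvec norm_power)
  then show "1 \<in> (\<lambda>x. cmod (ext_sum n N (\<lambda>_. 1) x) / real N ^ n) ` zmod_vec (Suc n) N"
    using zvec_mem[OF N] by blast
qed simp

text \<open>The supremum is a maximum: \<open>linfnorm_fourier_le\<close> bounds every quotient and
  \<open>unit_density\<close> attains the bound.\<close>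

lemma synthesis_const_paraboloid:
  assumes N: "N > 0" and r: "r \<ge> 1"
  shows "synthesis_const (Suc n) N r (paraboloid (Suc n) N) = kernel_mass n N r powr (- 1 / r)"
  unfolding synthesis_const_def
proof (rule cSup_eq_maximum)
  let ?u = "unit_density n N"
  have "kernel_mass n N r powr (- 1 / r) = 1 / kernel_mass n N r powr (1 / r)"
    using powr_minus_divide[of "kernel_mass n N r" "1 / r"] by simp
  then have "kernel_mass n N r powr (- 1 / r)
      = linfnorm (Suc n) N (fourier (Suc n) N ?u) / lnorm (Suc n) N r (fourier (Suc n) N ?u)"
    by (simp only: linfnorm_fourier_unit_density[OF N] lnorm_fourier_unit_density[OF N])
  moreover have "supp (Suc n) N ?u \<noteq> {}"
    using zmod_vec_nonempty[OF N] by (simp add: supp_unit_density[OF N] paraboloid_Suc)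
  ultimately show "kernel_mass n N r powr (- 1 / r)
      \<in> {linfnorm (Suc n) N (fourier (Suc n) N f) / lnorm (Suc n) N r (fourier (Suc n) N f) |f.
           supp (Suc n) N f \<noteq> {} \<and> supp (Suc n) N f \<subseteq> paraboloid (Suc n) N}"
    using supp_unit_density[OF N, of n] by blast
next
  fix y
  assume "y \<in> {linfnorm (Suc n) N (fourier (Suc n) N f) / lnorm (Suc n) N r (fourier (Suc n) N f) |f.
           supp (Suc n) N f \<noteq> {} \<and> supp (Suc n) N f \<subseteq> paraboloid (Suc n) N}"
  then obtain f where f: "supp (Suc n) N f \<subseteq> paraboloid (Suc n) N"
    and y: "y = linfnorm (Suc n) N (fourier (Suc n) N f) / lnorm (Suc n) N r (fourier (Suc n) N f)"
    by auto
  have "lnorm (Suc n) N r (fourier (Suc n) N f) \<ge> 0"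
    by (simp add: lnorm_def)
  then show "y \<le> kernel_mass n N r powr (- 1 / r)"
    using linfnorm_fourier_le[OF N r f] unfolding y
    \<comment> \<open>For a vanishing norm the quotient is 0 by the convention for division by
      zero.\<close>
    by (cases "lnorm (Suc n) N r (fourier (Suc n) N f) = 0") (simp_all add: divide_le_eq)
qed

subsection \<open>The kernel for prime power moduli\<close>

text \<open>The phase is a sum of one-variable phases sharing the quadratic coefficient
  \<open>\<xi> n\<close>, so the sum over the box factors.\<close>

lemma ext_sum_eq_prod_gauss: "ext_sum n N (\<lambda>_. 1) \<xi> = (\<Prod>i<n. gauss N (\<xi> i) (\<xi> n))"
proof -
  have "ext_sum n N (\<lambda>_. 1) \<xi> = (\<Sum>t\<in>zmod_vec n N. \<Prod>i<n. chi N (- (t i * \<xi> i + (t i)\<^sup>2 * \<xi> n)))"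
    by (simp only: ext_sum_def quad_def chi_sum[symmetric] sum_negf[symmetric] mult_1)
  also have "\<dots> = (\<Prod>i<n. gauss N (\<xi> i) (\<xi> n))"
    unfolding gauss_def zmod_vec_def by (rule prod_sum_PiE[symmetric]) auto
  finally show ?thesis .
qed

text \<open>With \<open>G = gcd(b, N)\<close> and \<open>q = N / G\<close>, the normalized Gauss sum
  has modulus \<open>q^(-1/2)\<close> on the \<open>q\<close> multiples of \<open>G\<close> and
  vanishes elsewhere.\<close>

lemma sum_norm_gauss_powr:
  fixes r :: real
  assumes N: "N > 0" "odd N"
  shows "(\<Sum>a\<in>{0..<int N}. (cmod (gauss N a b) / real N) powr r)
    = real (N div nat (gcd b (int N))) powr (1 - r / 2)"
proof -
  define G where "G = nat (gcd b (int N))"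
  define q where "q = N div G"
  have G: "int G = gcd b (int N)"
    by (simp add: G_def)
  then have G0: "G > 0"
    using N by (metis gcd_pos_int int_nat_eq of_nat_0_less_iff of_nat_0_eq_iff neq0_conv)
  have "int G dvd int N" using G by simp
  then have NqG: "N = G * q" by (simp add: q_def)
  then have q0: "q > 0" using N by auto
  have term_eq: "(cmod (gauss N a b) / real N) powr r = (if int G dvd a then real q powr (- r / 2) else 0)" for a
  proof (cases "int G dvd a")
    case True
    have "(cmod (gauss N a b))\<^sup>2 = real N * real G"
      using norm_gauss_square[OF N, of a b] True by (simp add: G_def)
    then have "(cmod (gauss N a b) / real N)\<^sup>2 = 1 / real q"
      using G0 q0 by (simp add: power_divide NqG power2_eq_square)
    then have "cmod (gauss N a b) / real N = (1 / real q) powr (1 / 2)"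
      by (metis norm_ge_zero of_nat_0_le_iff divide_nonneg_nonneg powr_half_sqrt real_sqrt_abs
          abs_of_nonneg zero_le_one)
    then show ?thesis
      using True q0 by (simp add: powr_powr powr_divide powr_minus_divide)
  next
    case False
    then have "cmod (gauss N a b) = 0"
      using norm_gauss_square[OF N, of a b] by (simp add: G_def)
    with False show ?thesis by simp
  qed
  have "(\<Sum>a\<in>{0..<int N}. (cmod (gauss N a b) / real N) powr r)
      = (\<Sum>s\<in>{0..<int q}. real q powr (- r / 2))"
    unfolding term_eq by (rule sum_residues_dvd[OF G0 q0 NqG])
  also have "\<dots> = real q powr 1 * real q powr (- r / 2)"
    using q0 by simp
  also have "\<dots> = real q powr (1 - r / 2)"
    using powr_add[of "real q" 1 "- r / 2"] by simp
  finally show ?thesis by (simp add: q_def G_def)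
qed

lemma kernel_mass_eq_sum:
  assumes N: "N > 0" "odd N"
  shows "kernel_mass n N r = (\<Sum>b\<in>{0..<int N}. (real (N div nat (gcd b (int N))) powr (1 - r / 2)) ^ n)"
proof -
  have "kernel_mass n N r = (\<Sum>\<xi>\<in>zmod_vec (Suc n) N. \<Prod>i<n. (cmod (gauss N (\<xi> i) (\<xi> n)) / real N) powr r)"
    unfolding kernel_mass_def
  proof (intro sum.cong refl)
    fix \<xi> :: "nat \<Rightarrow> int"
    have "cmod (ext_sum n N (\<lambda>_. 1) \<xi>) / real N ^ n = (\<Prod>i<n. cmod (gauss N (\<xi> i) (\<xi> n)) / real N)"
      by (simp add: ext_sum_eq_prod_gauss prod_norm[symmetric] prod_dividef)
    then show "(cmod (ext_sum n N (\<lambda>_. 1) \<xi>) / real N ^ n) powr r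
        = (\<Prod>i<n. (cmod (gauss N (\<xi> i) (\<xi> n)) / real N) powr r)"
      by (simp add: prod_powr_distrib)
  qed
  also have "\<dots> = (\<Sum>b\<in>{0..<int N}. \<Sum>y\<in>zmod_vec n N. \<Prod>i<n. (cmod (gauss N (y i) b) / real N) powr r)"
    by (simp add: sum_zmod_vec_Suc)
  also have "\<dots> = (\<Sum>b\<in>{0..<int N}. \<Prod>i<n. \<Sum>a\<in>{0..<int N}. (cmod (gauss N a b) / real N) powr r)"
    unfolding zmod_vec_def by (intro sum.cong refl prod_sum_PiE[symmetric]) auto
  also have "\<dots> = (\<Sum>b\<in>{0..<int N}. (real (N div nat (gcd b (int N))) powr (1 - r / 2)) ^ n)"
    by (simp add: sum_norm_gauss_powr[OF N])
  finally show ?thesis .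
qed

text \<open>The weight of \<open>h (l^m)\<close> is Euler's totient of \<open>l^m\<close>. The
  induction separates the residues prime to \<open>l\<close>, all with value
  \<open>h (l ^ Suc k)\<close>, from the multiples of \<open>l\<close>, which reproduce the sum for
  \<open>l ^ k\<close>.\<close>

lemma sum_gcd_prime_power:
  fixes h :: "nat \<Rightarrow> real"
  assumes l: "prime l"
  shows "(\<Sum>b\<in>{0..<int (l ^ k)}. h (l ^ k div nat (gcd b (int (l ^ k)))))
    = h 1 + (\<Sum>m=1..k. (1 - 1 / real l) * real l ^ m * h (l ^ m))"
proof (induction k)
  case 0
  then show ?case by simp
next
  case (Suc k)
  have l0: "l > 0" using l prime_gt_0_nat by blast
  let ?N = "l ^ Suc k"
  let ?f = "\<lambda>b. h (?N div nat (gcd b (int ?N)))"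
  have "\<not> int l dvd b \<Longrightarrow> ?f b = h ?N" for b
  proof -
    assume "\<not> int l dvd b"
    then have "coprime (int l) b"
      using l by (intro prime_imp_coprime) auto
    then have "coprime b (int l ^ Suc k)"
      by (simp only: coprime_commute[of b] coprime_power_left_iff) simp
    then show ?thesis by simp
  qed
  \<comment> \<open>The sum over non-multiples of \<open>l\<close> is written as the full sum minus
    the sum over multiples, so that \<open>sum_residues_dvd\<close> handles both pieces.\<close>
  then have "(\<Sum>b\<in>{0..<int ?N}. ?f b)
      = (\<Sum>b\<in>{0..<int ?N}. (if int l dvd b then ?f b else 0) + (h ?N - (if int l dvd b then h ?N else 0)))"
    by (intro sum.cong refl) auto
  also have "\<dots> = (\<Sum>b\<in>{0..<int ?N}. if int l dvd b then ?f b else 0)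
      + ((\<Sum>b\<in>{0..<int ?N}. h ?N) - (\<Sum>b\<in>{0..<int ?N}. if int l dvd b then h ?N else 0))"
    by (simp only: sum.distrib sum_subtractf)
  also have "(\<Sum>b\<in>{0..<int ?N}. if int l dvd b then h ?N else 0) = (\<Sum>s\<in>{0..<int (l ^ k)}. h ?N)"
    by (rule sum_residues_dvd) (use l0 in auto)
  also have "(\<Sum>b\<in>{0..<int ?N}. if int l dvd b then ?f b else 0) = (\<Sum>s\<in>{0..<int (l ^ k)}. ?f (int l * s))"
    by (rule sum_residues_dvd) (use l0 in auto)
  also have "\<dots> = (\<Sum>s\<in>{0..<int (l ^ k)}. h (l ^ k div nat (gcd s (int (l ^ k)))))"
  proof (intro sum.cong refl arg_cong[of _ _ h])
    fix s
    have "gcd (int l * s) (int ?N) = int l * gcd s (int (l ^ k))"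
      using gcd_mult_distrib_int[of "int l" s "int (l ^ k)"] by simp
    then show "?N div nat (gcd (int l * s) (int ?N)) = l ^ k div nat (gcd s (int (l ^ k)))"
      using l0 by (simp add: nat_mult_distrib)
  qed
  also note Suc.IH
  also have "(\<Sum>b\<in>{0..<int ?N}. h ?N) - (\<Sum>s\<in>{0..<int (l ^ k)}. h ?N)
      = (1 - 1 / real l) * real l ^ Suc k * h ?N"
    using l0 by (simp add: field_simps)
  finally show ?case by simp
qed

text \<open>
  The exponent \<open>1 + n (1 - r / 2)\<close> equals \<open>n (r\<^sub>c - r) / 2\<close>, so its sign decides the three regimes.
\<close>

lemma kernel_mass_prime_power:
  assumes l: "prime l" "odd l"
  shows "kernel_mass n (l ^ k) r
    = 1 + (1 - 1 / real l) * (\<Sum>m=1..k. (real l powr (1 + real n * (1 - r / 2))) ^ m)"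
proof -
  have l0: "l > 0" using l prime_gt_0_nat by blast
  have "real l ^ m * (real (l ^ m) powr (1 - r / 2)) ^ n = (real l powr (1 + real n * (1 - r / 2))) ^ m" for m
  proof -
    have "real l ^ m * (real (l ^ m) powr (1 - r / 2)) ^ n
        = real l powr real m * ((real l powr real m) powr (1 - r / 2)) powr real n"
      using l0 by (simp add: powr_realpow)
    also have "\<dots> = real l powr (real m + real m * (1 - r / 2) * real n)"
      by (simp add: powr_powr powr_add)
    also have "\<dots> = real l powr ((1 + real n * (1 - r / 2)) * real m)"
      by (simp add: algebra_simps)
    also have "\<dots> = (real l powr (1 + real n * (1 - r / 2))) ^ m"
      using l0 by (simp add: powr_powr flip: powr_realpow)
    finally show ?thesis .
  qed
  then show ?thesis
    using l l0 sum_gcd_prime_power[OF l(1), of "\<lambda>q. (real q powr (1 - r / 2)) ^ n" k]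
    by (simp add: kernel_mass_eq_sum sum_distrib_left mult.assoc del: of_nat_power)
qed

section \<open>Growth of the kernel mass and asymptotics of the constant\<close>

text \<open>The mass is governed by a geometric sum with ratio \<open>x = l powr \<alpha>\<close>:
  its last term dominates for \<open>x > 1\<close>, it has \<open>k\<close> equal terms for
  \<open>x = 1\<close>, and it stays bounded for \<open>x < 1\<close>.\<close>

lemma kernel_mass_growth:
  assumes l: "prime l" "odd l" and n: "n \<ge> 1" and r: "r \<ge> 1"
  defines "\<rho> \<equiv> critical_exponent (Suc n)" and "\<alpha> \<equiv> 1 + real n * (1 - r / 2)"
  defines "Y \<equiv> \<lambda>k. if r < \<rho> then real (l ^ k) powr \<alpha> else if r = \<rho> then ln (real (l ^ k)) else 1"
  shows "\<exists>c>0. \<exists>C>0. \<forall>k\<ge>1. c * Y k \<le> kernel_mass n (l ^ k) r \<and> kernel_mass n (l ^ k) r \<le> C * Y k"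
proof -
  define x where "x = real l powr \<alpha>"
  define S where "S = (\<lambda>k. \<Sum>m=1..k. x ^ m)"
  define \<theta> where "\<theta> = 1 - 1 / real l"
  have l1: "real l > 1" using l prime_gt_1_nat by force
  then have \<theta>: "0 < \<theta>" "\<theta> \<le> 1" by (auto simp: \<theta>_def)
  have x0: "x > 0" using l1 by (simp add: x_def)
  have K: "kernel_mass n (l ^ k) r = 1 + \<theta> * S k" for k
    unfolding kernel_mass_prime_power[OF l] by (simp add: \<theta>_def S_def x_def \<alpha>_def)
  have \<alpha>: "\<alpha> = real n / 2 * (\<rho> - r)"
    using n by (simp add: \<alpha>_def \<rho>_def critical_exponent_def field_simps)
  have geom: "(x - 1) * S k = x * (x ^ k - 1)" for k
    unfolding S_def by (induction k) (simp_all add: algebra_simps)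
  have S0: "S k \<ge> 0" for k
    unfolding S_def using x0 by (intro sum_nonneg) auto
  consider "r < \<rho>" | "r = \<rho>" | "r > \<rho>" by linarith
  then show ?thesis
  proof cases
    case 1
    then have "\<alpha> > 0" using n by (simp add: \<alpha>)
    then have x1: "x > 1" using l1 by (simp add: x_def gr_one_powr)
    have Y: "Y k = x ^ k" for k
      using 1 l1 by (simp add: Y_def x_def powr_powr powr_realpow[symmetric] mult.commute)
    \<comment> \<open>The lower constant keeps only the term \<open>m = k\<close>; the upper one
      adds 1 for the leading term to \<open>x / (x - 1)\<close> from the closed form.\<close>
    have "\<theta> * x ^ k \<le> 1 + \<theta> * S k \<and> 1 + \<theta> * S k \<le> (1 + x / (x - 1)) * x ^ k" if "k \<ge> 1" for k
    proof
      have "x ^ k \<le> S k"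
        unfolding S_def by (rule member_le_sum) (use x0 that in auto)
      then have "\<theta> * x ^ k \<le> \<theta> * S k"
        using \<theta> by (intro mult_left_mono) auto
      then show "\<theta> * x ^ k \<le> 1 + \<theta> * S k" by simp
      have "S k = x * (x ^ k - 1) / (x - 1)"
        using geom[of k] x1 by (simp add: field_simps)
      also have "\<dots> \<le> x * x ^ k / (x - 1)"
        using x1 by (intro divide_right_mono mult_left_mono) auto
      finally have "S k \<le> x / (x - 1) * x ^ k" by simp
      moreover have "\<theta> * S k \<le> 1 * S k"
        using \<theta> S0 by (intro mult_right_mono) auto
      moreover have "1 \<le> x ^ k" using x1 by (simp add: one_le_power)
      ultimately show "1 + \<theta> * S k \<le> (1 + x / (x - 1)) * x ^ k"
        by (simp add: distrib_right)
    qed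
    with \<theta> x1 show ?thesis
      unfolding K Y by (intro exI[of _ \<theta>] conjI exI[of _ "1 + x / (x - 1)"]) (auto intro: add_pos_pos)
  next
    case 2
    then have "x = 1" using l1 by (simp add: x_def \<alpha>)
    then have S: "S k = real k" for k by (simp add: S_def)
    have Y: "Y k = real k * ln (real l)" for k
      using 2 l1 by (simp add: Y_def ln_realpow)
    have ln: "ln (real l) > 0" using l1 by simp
    \<comment> \<open>Division by \<open>ln l\<close> converts \<open>Y k\<close> back to
      \<open>k\<close>, and the 2 absorbs the leading 1 because \<open>k \<ge> 1\<close>.\<close>
    have "\<theta> / ln (real l) * Y k \<le> 1 + \<theta> * S k \<and> 1 + \<theta> * S k \<le> 2 / ln (real l) * Y k" if "k \<ge> 1" for k
    proof
      show "\<theta> / ln (real l) * Y k \<le> 1 + \<theta> * S k"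
        using ln by (simp add: Y S)
      have "\<theta> * real k \<le> 1 * real k"
        using \<theta> by (intro mult_right_mono) auto
      then have "1 + \<theta> * S k \<le> 2 * real k"
        using that unfolding S by linarith
      then show "1 + \<theta> * S k \<le> 2 / ln (real l) * Y k"
        using ln by (simp add: Y)
    qed
    with \<theta> ln show ?thesis
      unfolding K by (intro exI[of _ "\<theta> / ln (real l)"] conjI exI[of _ "2 / ln (real l)"]) auto
  next
    case 3
    then have "\<alpha> < 0" using n by (simp add: \<alpha> mult_less_0_iff)
    then have x1: "x < 1" using l1 by (simp add: x_def powr_less_one)
    have "1 + \<theta> * S k \<le> 1 + x / (1 - x)" for k
    proof -
      have "(1 - x) * S k = x * (1 - x ^ k)"
        using geom[of k] by (simp add: algebra_simps)
      also have "\<dots> \<le> x * 1"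
        using x0 by (intro mult_left_mono) auto
      finally have "S k \<le> x / (1 - x)"
        using x1 by (simp add: field_simps)
      moreover have "\<theta> * S k \<le> 1 * S k"
        using \<theta> S0 by (intro mult_right_mono) auto
      ultimately show ?thesis by simp
    qed
    moreover have "1 \<le> 1 + \<theta> * S k" for k
      using \<theta> S0[of k] by simp
    moreover have "Y k = 1" for k using 3 by (simp add: Y_def)
    moreover have "1 + x / (1 - x) > 0" using x0 x1 by (simp add: add_pos_pos)
    ultimately show ?thesis
      unfolding K by (intro exI[of _ 1] conjI exI[of _ "1 + x / (1 - x)"]) auto
  qed
qed

text \<open>Raise the bounds of \<open>kernel_mass_growth\<close> to the power \<open>-1/r\<close>.
  This reverses the inequalities, so \<open>C\<close> yields the lower constant and \<open>c\<close>
  the upper one.\<close>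

lemma synthesis_const_asymp:
  assumes l: "prime l" "odd l" and n: "n \<ge> 1" and r: "r \<ge> 1"
  defines "\<rho> \<equiv> critical_exponent (Suc n)"
  defines "B \<equiv> \<lambda>k. if r < \<rho> then real (l ^ k) powr (real n / 2 - real (Suc n) / r)
      else if r = \<rho> then ln (real (l ^ k)) powr (- 1 / \<rho>) else 1"
  shows "\<exists>c>0. \<exists>C>0. \<forall>k\<ge>1. c * B k \<le> synthesis_const (Suc n) (l ^ k) r (paraboloid (Suc n) (l ^ k))
      \<and> synthesis_const (Suc n) (l ^ k) r (paraboloid (Suc n) (l ^ k)) \<le> C * B k"
proof -
  define \<alpha> where "\<alpha> = 1 + real n * (1 - r / 2)"
  define Y where "Y = (\<lambda>k. if r < \<rho> then real (l ^ k) powr \<alpha> else if r = \<rho> then ln (real (l ^ k)) else 1)"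
  have l1: "real l > 1" using l prime_gt_1_nat by force
  obtain c C where c: "c > 0" and C: "C > 0"
    and bounds: "\<And>k. k \<ge> 1 \<Longrightarrow> c * Y k \<le> kernel_mass n (l ^ k) r \<and> kernel_mass n (l ^ k) r \<le> C * Y k"
    using kernel_mass_growth[OF l n r] unfolding Y_def \<rho>_def \<alpha>_def by blast
  have exponent: "\<alpha> * (- 1 / r) = real n / 2 - real (Suc n) / r"
    using r by (simp add: \<alpha>_def field_simps)
  have B: "B k = Y k powr (- 1 / r)" for k
    unfolding B_def Y_def exponent[symmetric] by (simp add: powr_powr)
  have syn: "synthesis_const (Suc n) (l ^ k) r (paraboloid (Suc n) (l ^ k)) = kernel_mass n (l ^ k) r powr (- 1 / r)" for k
    using l1 r by (intro synthesis_const_paraboloid) auto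
  have "C powr (- 1 / r) * B k \<le> kernel_mass n (l ^ k) r powr (- 1 / r)
      \<and> kernel_mass n (l ^ k) r powr (- 1 / r) \<le> c powr (- 1 / r) * B k" if k: "k \<ge> 1" for k
  proof -
    \<comment> \<open>The case \<open>k = 0\<close> must be excluded: there the logarithm at the
      critical exponent would be 0.\<close>
    have "real (l ^ k) > 1" using l1 k by (simp add: one_less_power)
    then have "ln (real (l ^ k)) > 0" "real (l ^ k) > 0" by (rule ln_gt_zero, linarith)
    then have Y: "Y k > 0" by (simp add: Y_def del: of_nat_power)
    have m: "kernel_mass n (l ^ k) r > 0"
      using kernel_mass_ge_1[of "l ^ k" n r] l1 by simp
    have "(C * Y k) powr (- 1 / r) \<le> kernel_mass n (l ^ k) r powr (- 1 / r)"
      using bounds[OF k] m r by (intro powr_mono2') auto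
    moreover have "kernel_mass n (l ^ k) r powr (- 1 / r) \<le> (c * Y k) powr (- 1 / r)"
      using bounds[OF k] Y c r by (intro powr_mono2') auto
    ultimately show ?thesis
      using c C Y by (simp add: B powr_mult)
  qed
  with c C show ?thesis
    unfolding syn by (intro exI[of _ "C powr (- 1 / r)"] conjI exI[of _ "c powr (- 1 / r)"]) auto
qed

text \<open>Up to and including the critical exponent the ratio is at least 1, so every term of the
  geometric sum is at least 1 and the mass grows at least linearly in \<open>k\<close>.\<close>

lemma kernel_mass_at_top:
  assumes l: "prime l" "odd l" and n: "n \<ge> 1" and r: "r \<le> critical_exponent (Suc n)"
  shows "filterlim (\<lambda>k. kernel_mass n (l ^ k) r) at_top sequentially"
proof -
  define x where "x = real l powr (1 + real n * (1 - r / 2))"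
  have l1: "real l > 1" using l prime_gt_1_nat by force
  then have \<theta>: "1 - 1 / real l > 0" by simp
  have exponent: "1 + real n * (1 - r / 2) = real n / 2 * (critical_exponent (Suc n) - r)"
    using n by (simp add: critical_exponent_def field_simps)
  have "1 + real n * (1 - r / 2) \<ge> 0" unfolding exponent using r by simp
  then have x: "x \<ge> 1" using l1 by (simp add: x_def ge_one_powr_ge_zero)
  have "kernel_mass n (l ^ k) r \<ge> (1 - 1 / real l) * real k" for k
  proof -
    have "real k = (\<Sum>m=1..k. 1 :: real)" by simp
    also have "\<dots> \<le> (\<Sum>m=1..k. x ^ m)"
      using x by (intro sum_mono one_le_power) auto
    finally have "(1 - 1 / real l) * real k \<le> (1 - 1 / real l) * (\<Sum>m=1..k. x ^ m)"
      using \<theta> by (intro mult_left_mono) auto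
    then show ?thesis
      by (simp add: kernel_mass_prime_power[OF l] x_def)
  qed
  then have "\<forall>\<^sub>F k in sequentially. (1 - 1 / real l) * real k \<le> kernel_mass n (l ^ k) r"
    by (intro always_eventually allI)
  moreover have "filterlim (\<lambda>k. (1 - 1 / real l) * real k) at_top sequentially"
    by (rule filterlim_tendsto_pos_mult_at_top[OF tendsto_const \<theta> filterlim_real_sequentially])
  ultimately show ?thesis
    by (rule filterlim_at_top_mono[rotated])
qed

section \<open>Limits along prime powers and uniform spectral synthesis\<close>

lemma tendsto_powers_iff:
  fixes F :: "nat \<Rightarrow> 'a::topological_space"
  assumes "l > 1"
  shows "(F \<longlongrightarrow> L) (inf at_top (principal {l ^ k |k. k \<ge> 1})) \<longleftrightarrow> (\<lambda>k. F (l ^ k)) \<longlonglongrightarrow> L"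
proof -
  have "eventually P (inf at_top (principal {l ^ k |k. k \<ge> 1})) \<longleftrightarrow> (\<forall>\<^sub>F k in sequentially. P (l ^ k))" for P
  proof
    assume "eventually P (inf at_top (principal {l ^ k |k. k \<ge> 1}))"
    then obtain N0 where N0: "\<And>N. N \<ge> N0 \<Longrightarrow> N \<in> {l ^ k |k. k \<ge> 1} \<Longrightarrow> P N"
      unfolding eventually_inf_principal eventually_at_top_linorder by blast
    \<comment> \<open>The successor also ensures \<open>k \<ge> 1\<close>, so that
      \<open>l ^ k\<close> lies in the set; its size follows from
      \<open>k < 2 ^ k \<le> l ^ k\<close>.\<close>
    have "P (l ^ k)" if "k \<ge> Suc N0" for k
    proof (rule N0)
      show "l ^ k \<ge> N0"
        using that less_exp[of k] power_mono[of 2 l k] assms by linarith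
    qed (use that in auto)
    then show "\<forall>\<^sub>F k in sequentially. P (l ^ k)"
      unfolding eventually_sequentially by blast
  next
    assume "\<forall>\<^sub>F k in sequentially. P (l ^ k)"
    then obtain K where K: "\<And>k. k \<ge> K \<Longrightarrow> P (l ^ k)"
      unfolding eventually_sequentially by blast
    have "P N" if "N \<ge> l ^ K" "N \<in> {l ^ k |k. k \<ge> 1}" for N
      using that K assms by (auto simp: power_increasing_iff)
    then show "eventually P (inf at_top (principal {l ^ k |k. k \<ge> 1}))"
      unfolding eventually_inf_principal eventually_at_top_linorder by blast
  qed
  then show ?thesis
    by (simp add: tendsto_def)
qed

text \<open>If \<open>r\<close> is at most critical, the mass diverges and the factor in
  \<open>linfnorm_fourier_le\<close> tends to 0. Above it the mass is bounded, so the unit densities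
  have bounded \<open>r\<close>-norms but sup norm 1.\<close>

lemma uniform_spectral_synthesis_iff:
  assumes l: "prime l" "odd l" and n: "n \<ge> 1" and r: "r \<ge> 1"
  shows "uniform_spectral_synthesis (Suc n) r {l ^ k |k. k \<ge> 1} (paraboloid (Suc n))
    \<longleftrightarrow> r \<le> critical_exponent (Suc n)"
proof
  have l1: "l > 1" using l prime_gt_1_nat by blast
  then have pos: "l ^ k > 0" for k by simp
  let ?M = "{l ^ k |k. k \<ge> 1}"
  {
    assume crit: "r \<le> critical_exponent (Suc n)"
    show "uniform_spectral_synthesis (Suc n) r ?M (paraboloid (Suc n))"
      unfolding uniform_spectral_synthesis_def
    proof (intro allI impI)
      fix f
      let ?F = "\<lambda>N. fourier (Suc n) N (f N)"
      assume supp: "\<forall>N\<in>?M. supp (Suc n) N (f N) \<subseteq> paraboloid (Suc n) N"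
        and "bdd_above ((\<lambda>N. lnorm (Suc n) N r (?F N)) ` ?M)"
      then obtain C where C: "\<And>N. N \<in> ?M \<Longrightarrow> lnorm (Suc n) N r (?F N) \<le> C"
        unfolding bdd_above_def by blast
      have "linfnorm (Suc n) (l ^ k) (?F (l ^ k)) \<le> kernel_mass n (l ^ k) r powr (- 1 / r) * C" if "k \<ge> 1" for k
      proof -
        have M: "l ^ k \<in> ?M" using that by blast
        have "linfnorm (Suc n) (l ^ k) (?F (l ^ k))
            \<le> kernel_mass n (l ^ k) r powr (- 1 / r) * lnorm (Suc n) (l ^ k) r (?F (l ^ k))"
          using M supp by (intro linfnorm_fourier_le pos r) blast
        also have "\<dots> \<le> kernel_mass n (l ^ k) r powr (- 1 / r) * C"
          using C[OF M] by (intro mult_left_mono) auto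
        finally show ?thesis .
      qed
      then have upper: "\<forall>\<^sub>F k in sequentially.
          linfnorm (Suc n) (l ^ k) (?F (l ^ k)) \<le> kernel_mass n (l ^ k) r powr (- 1 / r) * C"
        unfolding eventually_sequentially by blast
      have nonneg: "0 \<le> linfnorm (Suc n) (l ^ k) (?F (l ^ k))" for k
      proof -
        have "linfnorm (Suc n) (l ^ k) (?F (l ^ k)) \<in> (\<lambda>x. cmod (?F (l ^ k) x)) ` zmod_vec (Suc n) (l ^ k)"
          unfolding linfnorm_def using zmod_vec_nonempty[OF pos] by (intro Max_in) auto
        then show ?thesis by auto
      qed
      have "- 1 / r < 0" using r by simp
      then have "(\<lambda>k. kernel_mass n (l ^ k) r powr (- 1 / r) * C) \<longlonglongrightarrow> 0"
        by (rule tendsto_mult_left_zero[OF tendsto_neg_powr[OF _ kernel_mass_at_top[OF l n crit]]])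
      then have "(\<lambda>k. linfnorm (Suc n) (l ^ k) (?F (l ^ k))) \<longlonglongrightarrow> 0"
        by (rule tendsto_sandwich[OF always_eventually upper tendsto_const, rotated]) (simp add: nonneg)
      then show "((\<lambda>N. linfnorm (Suc n) N (?F N)) \<longlongrightarrow> 0) (inf at_top (principal ?M))"
        by (simp only: tendsto_powers_iff[OF l1])
    qed
  }
  {
    assume synth: "uniform_spectral_synthesis (Suc n) r ?M (paraboloid (Suc n))"
    show "r \<le> critical_exponent (Suc n)"
    proof (rule ccontr)
      assume "\<not> r \<le> critical_exponent (Suc n)"
      then obtain C where C: "\<And>k. k \<ge> 1 \<Longrightarrow> kernel_mass n (l ^ k) r \<le> C"
        using kernel_mass_growth[OF l n r] by auto
      let ?F = "\<lambda>N. fourier (Suc n) N (unit_density n N)"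
      have "lnorm (Suc n) N r (?F N) \<le> C powr (1 / r)" if N: "N \<in> ?M" for N
      proof -
        obtain k where k: "N = l ^ k" "k \<ge> 1" using N by blast
        show ?thesis
          unfolding k lnorm_fourier_unit_density[OF pos]
          using C[OF k(2)] kernel_mass_ge_1[OF pos[of k], of n r] r by (intro powr_mono2) auto
      qed
      then have "bdd_above ((\<lambda>N. lnorm (Suc n) N r (?F N)) ` ?M)"
        by (intro bdd_aboveI[of _ "C powr (1 / r)"]) blast
      moreover have "\<forall>N\<in>?M. supp (Suc n) N (unit_density n N) \<subseteq> paraboloid (Suc n) N"
        by (auto simp: supp_unit_density[OF pos])
      ultimately have "((\<lambda>N. linfnorm (Suc n) N (?F N)) \<longlongrightarrow> 0) (inf at_top (principal ?M))"
        using synth unfolding uniform_spectral_synthesis_def by blast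
      then have "(\<lambda>k. linfnorm (Suc n) (l ^ k) (?F (l ^ k))) \<longlonglongrightarrow> 0"
        by (simp only: tendsto_powers_iff[OF l1])
      then show False
        by (simp add: linfnorm_fourier_unit_density[OF pos] LIMSEQ_const_iff)
    qed
  }
qed

theorem corollary6p4:
  fixes d l :: nat
  assumes "d \<ge> 2" and "prime l" and "odd l"
  shows
    "(\<forall>r::real. 1 \<le> r \<longrightarrow>
        (uniform_spectral_synthesis d r {l ^ k | k. k \<ge> 1} (paraboloid d)
           \<longleftrightarrow> r \<le> critical_exponent d)) \<and>
     (\<forall>r::real. 1 \<le> r \<longrightarrow>
        (\<exists>c>0. \<exists>C>0. \<forall>k\<ge>1.
           let N = l ^ k;
               A = synthesis_const d N r (paraboloid d N);
               B = (if r < critical_exponent d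
                      then real N powr ((real d - 1) / 2 - real d / r)
                    else if r = critical_exponent d
                      then ln (real N) powr (- 1 / critical_exponent d)
                    else 1)
           in c * B \<le> A \<and> A \<le> C * B)) \<and>
     (\<forall>k\<ge>1. synthesis_const d (l ^ k) (critical_exponent d) (paraboloid d (l ^ k))
        = (1 + real k * (1 - 1 / real l)) powr (- 1 / critical_exponent d))"
proof -
  obtain n where d: "d = Suc n" and n: "n \<ge> 1"
    using assms(1) by (metis Suc_le_D Suc_le_mono numeral_2_eq_2 One_nat_def)
  note l = assms(2,3)
  have dn: "real d - 1 = real n" by (simp add: d)
  have endpoint: "synthesis_const d (l ^ k) (critical_exponent d) (paraboloid d (l ^ k))
      = (1 + real k * (1 - 1 / real l)) powr (- 1 / critical_exponent d)" for k
  proof -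
    \<comment> \<open>The exponent of the ratio vanishes, so the geometric sum is exactly
      \<open>k\<close>.\<close>
    have "critical_exponent d \<ge> 1" "1 + real n * (1 - critical_exponent d / 2) = 0"
      using n by (simp_all add: critical_exponent_def d field_simps)
    then have "kernel_mass n (l ^ k) (critical_exponent d) = 1 + real k * (1 - 1 / real l)"
      using prime_gt_0_nat[OF l(1)] by (simp add: kernel_mass_prime_power[OF l])
    then show ?thesis
      using \<open>critical_exponent d \<ge> 1\<close> prime_gt_0_nat[OF l(1)]
      by (simp add: d synthesis_const_paraboloid)
  qed
  have uniform: "uniform_spectral_synthesis d r {l ^ k | k. k \<ge> 1} (paraboloid d)
      \<longleftrightarrow> r \<le> critical_exponent d" if "r \<ge> 1" for r
    unfolding d by (rule uniform_spectral_synthesis_iff[OF l n that])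
  show ?thesis
    unfolding Let_def dn
    by (intro conjI allI impI uniform endpoint synthesis_const_asymp[OF l n, folded d])
qed

end
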